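(* For all $n\ge k\ge3$, \[ g^{\mathrm v}_n(1k)=\sum_{i=1}^{k-1}\beta_{k,i}\,b^{\mathrm v}_i\,g^{\mathrm v}_{n-i}+2\sqrt\theta^{\,n-1}\,\chi(n\text{ is odd and }k=n), \] where $\beta_{k,i}=\binom{k-2}{i-1}+\binom{k-3}{i-2}$ and $b^{\mathrm v}_i=(-1)^{i+1}\theta^{\lfloor i/2\rfloor}$.
   Context: $\mathcal S_n$ is the set of permutations of $[n]$. For $\pi\in\mathcal S_n$ written in standard cycle form (each cycle begins with its smallest element, cycles ordered left to right by increasing smallest elements), $\mathrm{Flatten}(\pi)$ is the word obtained by erasing the parentheses. For a word $w$, $\mathrm v(w)$ is the number of valleys, i.e. indices $i$ with $w_{i+1}=\min\{w_i,w_{i+1},w_{i+2}\}$. For letters $a_1,\dots,a_k$, $g^{\mathrm v}_n(a_1\cdots a_k)=\sum_\pi q^{\mathrm v(\mathrm{Flatten}(\pi))}$ over $\pi\in\mathcal S_n$ with $\mathrm{Flatten}(\pi)$ beginning with $a_1\cdots a_k$, and $g^{\mathrm v}_n=g^{\mathrm v}_n(1)$. Here $q$ is an indeterminate, $\theta=1-q$, $\chi(P)$ is $1$ if $P$ holds and $0$ otherwise, and binomial coefficients with negative lower index are $0$. *)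

theory Defs
  imports
    "HOL-Combinatorics.Combinatorics"
    "HOL-Computational_Algebra.Polynomial"
    "HOL-Library.Sublist"
begin

(* support p a = [a, p a, p (p a), ...], each element of the cycle of a listed once
   (so [a] if a is a fixed point). Keeping only the cycles whose starting letter is
   their minimum, with these minima increasing, gives the standard cycle form. *)
definition standard_cycle_form :: "nat \<Rightarrow> (nat \<Rightarrow> nat) \<Rightarrow> nat list list" where
  "standard_cycle_form n p =
     map (support p) (filter (\<lambda>a. a = Min (set (support p a))) [1..<Suc n])"

definition Flatten :: "nat \<Rightarrow> (nat \<Rightarrow> nat) \<Rightarrow> nat list" where
  "Flatten n p = concat (standard_cycle_form n p)"

definition valleys :: "nat list \<Rightarrow> nat" where
  "valleys w = card {i. i + 2 < length w \<and> w ! (i + 1) = Min {w ! i, w ! (i + 1), w ! (i + 2)}}"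

definition q :: "int poly" where
  "q = [:0, 1:]"

definition \<theta> :: "int poly" where
  "\<theta> = 1 - q"

definition g_v :: "nat \<Rightarrow> nat list \<Rightarrow> int poly" where
  "g_v n as = (\<Sum>p | p permutes {1..n} \<and> prefix as (Flatten n p). q ^ valleys (Flatten n p))"

(* The lower index is an integer, so that a negative one yields 0
   instead of being truncated to 0 by subtraction on nat. *)
definition binom :: "nat \<Rightarrow> int \<Rightarrow> nat" where
  "binom m j = (if j < 0 then 0 else m choose nat j)"

(* Only used for k \<ge> 3, where the upper indices are not truncated. *)
definition \<beta> :: "nat \<Rightarrow> nat \<Rightarrow> nat" where
  "\<beta> k i = binom (k - 2) (int i - 1) + binom (k - 3) (int i - 2)"

definition b_v :: "nat \<Rightarrow> int poly" where
  "b_v i = (-1) ^ (i + 1) * \<theta> ^ (i div 2)"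

end

theory Submission
  imports Defs
begin

text \<open>
  A word starting with \<open>1\<close> is the flattening of as many permutations as there are ways to cut
  it into cycles, and a cut is possible exactly in front of a right-to-left minimum. So
  \<open>g_v n\<close> sums \<open>2 ^ r * q ^ valleys w\<close> over words \<open>w\<close>, where \<open>r\<close> counts the right-to-left minima
  other than the initial \<open>1\<close>. Removing the initial \<open>1\<close> and renaming the letters to \<open>0, 1, \<dots>\<close>,
  let \<open>T m j\<close> be the sum over words of length \<open>m + 1\<close> that start with \<open>j\<close>; then
  \<open>g_v n [1, k] = T (n - 2) (k - 2)\<close>. Deleting the first letter loses a factor \<open>q = 1 - \<theta>\<close>
  only if the next letter is smaller and is followed by an ascent. Taking differences in \<open>j\<close> twice
  gives \<open>T m (j + 2) - 2 * T m (j + 1) + T m j = \<theta> * T (m - 2) j\<close>. By Pascal's rule, applied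
  twice, and \<open>b_v (i + 2) = \<theta> * b_v i\<close> the claimed closed form satisfies the same recursion,
  the extra term for odd \<open>n = k\<close> coming from the exceptional value \<open>T 1 1\<close>.
\<close>

section \<open>Valleys of words\<close>

lemma valleys_altdef:
  "valleys w = card {i. i + 2 < length w \<and> w ! (i + 1) \<le> w ! i \<and> w ! (i + 1) \<le> w ! (i + 2)}"
proof -
  have "w ! (i + 1) = Min {w ! i, w ! (i + 1), w ! (i + 2)} \<longleftrightarrow>
        w ! (i + 1) \<le> w ! i \<and> w ! (i + 1) \<le> w ! (i + 2)" for i
    by (simp add: min_def)
  then show ?thesis unfolding valleys_def by simp
qed

lemma valleys_short: "length w < 3 \<Longrightarrow> valleys w = 0"
  by (simp add: valleys_altdef)

lemma valleys_Cons:
  "valleys (x # y # z # w) = of_bool (y \<le> x \<and> y \<le> z) + valleys (y # z # w)"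
proof -
  let ?V = "\<lambda>w. {i. i + 2 < length w \<and> w ! (i + 1) \<le> w ! i \<and> w ! (i + 1) \<le> w ! (i + 2)}"
  have fin: "finite (?V w)" for w :: "nat list"
    by (rule finite_subset[of _ "{..<length w}"]) auto
  have eq: "?V (x # y # z # w) = (if y \<le> x \<and> y \<le> z then {0} else {}) \<union> Suc ` ?V (y # z # w)"
    (is "?L = ?R")
  proof (rule set_eqI)
    fix i show "i \<in> ?L \<longleftrightarrow> i \<in> ?R"
      by (cases i) auto
  qed
  show ?thesis
    unfolding valleys_altdef eq using fin[of "y # z # w"]
    by (subst card_Un_disjoint) (auto simp: card_image)
qed

lemma valleys_map:
  assumes "strict_mono f"
  shows "valleys (map f w) = valleys w"
proof -
  have "i + 2 < length w \<and> map f w ! (i + 1) \<le> map f w ! i \<and> map f w ! (i + 1) \<le> map f w ! (i + 2)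
    \<longleftrightarrow> i + 2 < length w \<and> w ! (i + 1) \<le> w ! i \<and> w ! (i + 1) \<le> w ! (i + 2)" for i
    using assms by (auto simp: strict_mono_less_eq)
  then show ?thesis unfolding valleys_altdef by simp
qed

lemma valleys_Cons_min:
  assumes "\<forall>y\<in>set w. x < y"
  shows "valleys (x # w) = valleys w"
proof (cases w)
  case Nil
  then show ?thesis by (simp add: valleys_short)
next
  case (Cons y v)
  with assms show ?thesis
    by (cases v) (simp_all add: valleys_Cons valleys_short)
qed


section \<open>Words with a given flattening\<close>

text \<open>This is 2 to the number of right-to-left minima: each of them may or may not open a new
  cycle.\<close>

fun flatten_weight :: "nat list \<Rightarrow> nat" where
  "flatten_weight [] = 1"
| "flatten_weight (x # w) = flatten_weight w * (if \<forall>y\<in>set w. x \<le> y then 2 else 1)"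

text \<open>Comparing the head with the letters of its own and of all later blocks says at once that
  a block starts with its minimum and that the heads never decrease.\<close>

fun standard_cycles :: "nat list list \<Rightarrow> bool" where
  "standard_cycles [] \<longleftrightarrow> True"
| "standard_cycles (c # cs) \<longleftrightarrow>
     c \<noteq> [] \<and> (\<forall>y\<in>set (concat (c # cs)). hd c \<le> y) \<and> standard_cycles cs"

text \<open>The first block is allowed to start with any letter, so that the recursion in
  \<open>card_cuttings\<close> can delete it.\<close>

definition cuttings :: "nat list \<Rightarrow> nat list list set" where
  "cuttings w = {css. concat css = w \<and> css \<noteq> [] \<and> hd css \<noteq> [] \<and> standard_cycles (tl css)}"

text \<open>Either \<open>y\<close> stays in the block of \<open>x\<close>, or it opens a block of
  its own, which is allowed exactly when no later letter is smaller.\<close>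

lemma cuttings_Cons:
  "cuttings (x # y # w) = (\<lambda>css. (x # hd css) # tl css) ` cuttings (y # w) \<union>
     (if \<forall>z\<in>set w. y \<le> z then (#) [x] ` cuttings (y # w) else {})" (is "?L = ?R")
proof (intro equalityI subsetI)
  fix css assume "css \<in> ?L"
  then obtain b bs where css: "css = b # bs" "b \<noteq> []" "standard_cycles bs" "b @ concat bs = x # y # w"
    by (cases css) (auto simp: cuttings_def)
  then obtain b' where b: "b = x # b'" "b' @ concat bs = y # w"
    by (cases b) auto
  show "css \<in> ?R"
  proof (cases b')
    case Nil
    then obtain c cs where bs: "bs = c # cs" "c \<noteq> []"
      using b css by (cases bs) auto
    then have "hd c = y" using b Nil by (cases c) auto
    moreover have "\<forall>z\<in>set (y # w). hd c \<le> z"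
      using css(3) b Nil bs by (metis append_Nil standard_cycles.simps(2))
    moreover have "bs \<in> cuttings (y # w)"
      using css b bs Nil by (auto simp: cuttings_def)
    ultimately show ?thesis
      using css b Nil by auto
  next
    case (Cons z b'')
    then have "b' # bs \<in> cuttings (y # w)"
      using css b by (auto simp: cuttings_def)
    then show ?thesis
      using css(1) b(1) by (auto intro!: image_eqI[of _ _ "b' # bs"])
  qed
next
  fix css assume "css \<in> ?R"
  then consider (ext) ds where "ds \<in> cuttings (y # w)" "css = (x # hd ds) # tl ds"
    | (new) ds where "ds \<in> cuttings (y # w)" "css = [x] # ds" "\<forall>z\<in>set w. y \<le> z"
    by (auto split: if_splits)
  then show "css \<in> ?L"
  proof cases
    case ext
    then show ?thesis by (cases ds) (auto simp: cuttings_def)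
  next
    case new
    then obtain b bs where ds: "ds = b # bs" "b \<noteq> []" "standard_cycles bs" "b @ concat bs = y # w"
      by (cases ds) (auto simp: cuttings_def)
    then have "hd b = y" by (cases b) auto
    moreover have "set (concat ds) = set (y # w)" using ds by simp
    ultimately have "standard_cycles ds"
      using ds new(3) by auto
    then show ?thesis using new ds by (auto simp: cuttings_def)
  qed
qed

lemma card_cuttings: "finite (cuttings (x # w)) \<and> card (cuttings (x # w)) = flatten_weight w"
proof (induction w arbitrary: x)
  case Nil
  have "css = [[x]]" if "css \<in> cuttings [x]" for css
  proof -
    from that obtain b bs where css: "css = b # bs" "b \<noteq> []" "standard_cycles bs" "b @ concat bs = [x]"
      by (cases css) (auto simp: cuttings_def)
    then have "b = [x]" "concat bs = []" by (cases b; auto)+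
    with css show ?thesis by (cases bs) auto
  qed
  moreover have "[[x]] \<in> cuttings [x]" by (simp add: cuttings_def)
  ultimately have "cuttings [x] = {[[x]]}" by blast
  then show ?case by simp
next
  case (Cons y w)
  let ?ext = "(\<lambda>css. (x # hd css) # tl css) ` cuttings (y # w)"
  let ?new = "(#) [x] ` cuttings (y # w)"
  have ne: "css \<noteq> [] \<and> hd css \<noteq> []" if "css \<in> cuttings (y # w)" for css
    using that by (auto simp: cuttings_def)
  have "inj_on (\<lambda>css. (x # hd css) # tl css) (cuttings (y # w))"
    by (rule inj_onI) (metis list.inject list.collapse ne)
  then have ext: "card ?ext = flatten_weight w"
    using Cons.IH by (simp add: card_image)
  have new: "card ?new = flatten_weight w"
    using Cons.IH by (simp add: card_image)
  \<comment> \<open>The first block has at least two letters in \<open>?ext\<close> and exactly one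
    in \<open>?new\<close>.\<close>
  have "?ext \<inter> ?new = {}" using ne by auto
  then show ?case
    unfolding cuttings_Cons using Cons.IH[of y] ext new
    by (auto simp: card_Un_disjoint)
qed

text \<open>If the word starts with its minimum, the condition on the first block, which
  \<open>cuttings\<close> leaves out, holds automatically.\<close>

lemma standard_cycles_eq_cuttings:
  assumes "\<forall>y\<in>set w. x \<le> y"
  shows "{css. standard_cycles css \<and> concat css = x # w} = cuttings (x # w)"
proof (intro equalityI subsetI)
  fix css assume "css \<in> {css. standard_cycles css \<and> concat css = x # w}"
  then show "css \<in> cuttings (x # w)"
    by (cases css) (auto simp: cuttings_def)
next
  fix css assume "css \<in> cuttings (x # w)"
  then obtain b bs where css: "css = b # bs" "b \<noteq> []" "standard_cycles bs" "b @ concat bs = x # w"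
    by (cases css) (auto simp: cuttings_def)
  then have "hd b = x" by (cases b) auto
  moreover have "set (concat css) = set (x # w)" using css by simp
  ultimately show "css \<in> {css. standard_cycles css \<and> concat css = x # w}"
    using css assms by auto
qed


section \<open>Standard cycle forms\<close>

text \<open>\<open>support\<close> is an abbreviation for a \<open>map\<close>, which the simplifier would take apart.\<close>

definition cycle_from :: "(nat \<Rightarrow> nat) \<Rightarrow> nat \<Rightarrow> nat list" where
  "cycle_from p a = support p a"

lemma cycle_from_subset:
  assumes "p permutes A" "a \<in> A"
  shows "set (cycle_from p a) \<subseteq> A"
proof -
  have "(p ^^ i) a \<in> A" for i
    by (induction i) (use assms in \<open>simp_all add: permutes_in_image\<close>)
  then show ?thesis by (auto simp: cycle_from_def)
qed

lemma mem_cycle_from_self: "permutation p \<Longrightarrow> a \<in> set (cycle_from p a)"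
  using least_power_of_permutation(2)[of p a] by (force simp: cycle_from_def)

lemma hd_cycle_from: "permutation p \<Longrightarrow> hd (cycle_from p a) = a"
  using least_power_of_permutation(2)[of p a]
  by (simp add: cycle_from_def hd_map upt_conv_Cons)

lemma set_cycle_from_eq:
  assumes "permutation p" "set (cycle_from p a) \<inter> set (cycle_from p b) \<noteq> {}"
  shows "set (cycle_from p a) = set (cycle_from p b)"
  using disjoint_support[OF assms(1)] assms(2)
  unfolding cycle_from_def by (meson UNIV_I disjoint_def image_iff)

definition cycle_minima :: "nat \<Rightarrow> (nat \<Rightarrow> nat) \<Rightarrow> nat list" where
  "cycle_minima n p = filter (\<lambda>a. a = Min (set (cycle_from p a))) [1..<Suc n]"

lemma set_cycle_minima:
  "set (cycle_minima n p) = {a \<in> {1..n}. a = Min (set (cycle_from p a))}"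
  by (auto simp: cycle_minima_def simp del: upt_Suc)

lemma standard_cycle_form_altdef:
  "standard_cycle_form n p = map (cycle_from p) (cycle_minima n p)"
  by (simp add: standard_cycle_form_def cycle_minima_def cycle_from_def[abs_def])

lemma set_Flatten:
  assumes "p permutes {1..n}"
  shows "set (Flatten n p) = {1..n}"
proof (intro equalityI subsetI)
  fix x assume "x \<in> set (Flatten n p)"
  then obtain a where "a \<in> {1..n}" "x \<in> set (cycle_from p a)"
    by (auto simp: Flatten_def standard_cycle_form_altdef set_cycle_minima)
  then show "x \<in> {1..n}" using cycle_from_subset[OF assms] by blast
next
  fix x assume x: "x \<in> {1..n}"
  have perm: "permutation p" using assms by (auto simp: permutation_permutes)
  \<comment> \<open>The minimum of the cycle through \<open>x\<close> generates the same cycle, so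
    \<open>x\<close> is listed with that minimum.\<close>
  define a where "a = Min (set (cycle_from p x))"
  have a: "a \<in> set (cycle_from p x)"
    unfolding a_def using mem_cycle_from_self[OF perm, of x] by (intro Min_in) auto
  then have eq: "set (cycle_from p a) = set (cycle_from p x)"
    using mem_cycle_from_self[OF perm, of a] by (intro set_cycle_from_eq[OF perm]) auto
  have "a \<in> {1..n}" using a cycle_from_subset[OF assms x] by blast
  then have "a \<in> set (cycle_minima n p)"
    unfolding set_cycle_minima using eq a_def by simp
  moreover have "x \<in> set (cycle_from p a)"
    unfolding eq by (rule mem_cycle_from_self[OF perm])
  ultimately show "x \<in> set (Flatten n p)"
    unfolding Flatten_def standard_cycle_form_altdef by auto
qed

lemma distinct_Flatten:
  assumes "p permutes {1..n}"
  shows "distinct (Flatten n p)"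
proof -
  have perm: "permutation p" using assms by (auto simp: permutation_permutes)
  have inj: "inj (cycle_from p)"
    by (rule injI) (metis hd_cycle_from perm)
  \<comment> \<open>Cycles that meet have the same letters, hence the same minimum.\<close>
  have disj: "a = b" if "a \<in> set (cycle_minima n p)" "b \<in> set (cycle_minima n p)"
    "set (cycle_from p a) \<inter> set (cycle_from p b) \<noteq> {}" for a b
    using set_cycle_from_eq[OF perm that(3)] that(1,2) unfolding set_cycle_minima by simp
  show ?thesis
    unfolding Flatten_def standard_cycle_form_altdef
  proof (rule distinct_concat)
    have "inj_on (cycle_from p) (set (cycle_minima n p))"
      using inj by (rule inj_on_subset) simp
    moreover have "distinct (cycle_minima n p)"
      unfolding cycle_minima_def by (intro distinct_filter distinct_upt)
    ultimately show "distinct (map (cycle_from p) (cycle_minima n p))"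
      by (simp add: distinct_map)
  next
    fix ys assume "ys \<in> set (map (cycle_from p) (cycle_minima n p))"
    then show "distinct ys"
      using cycle_of_permutation[OF perm] by (auto simp: cycle_from_def[symmetric])
  next
    fix ys zs
    assume "ys \<in> set (map (cycle_from p) (cycle_minima n p))"
      "zs \<in> set (map (cycle_from p) (cycle_minima n p))" "ys \<noteq> zs"
    then obtain a b where "ys = cycle_from p a" "a \<in> set (cycle_minima n p)"
      "zs = cycle_from p b" "b \<in> set (cycle_minima n p)" "a \<noteq> b"
      by auto
    with disj[of a b] show "set ys \<inter> set zs = {}" by blast
  qed
qed

lemma standard_cycles_map_cycle_from:
  assumes "permutation p" "sorted as" "\<forall>a\<in>set as. a = Min (set (cycle_from p a))"
  shows "standard_cycles (map (cycle_from p) as)"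
  using assms(2,3)
proof (induction as)
  case (Cons a as)
  have le: "b \<le> y" if "b \<in> set (a # as)" "y \<in> set (cycle_from p b)" for b y
    using Cons.prems(2) that by (metis List.finite_set Min_le)
  have "a \<le> y" if "y \<in> set (concat (map (cycle_from p) (a # as)))" for y
  proof -
    from that obtain b where b: "b \<in> set (a # as)" "y \<in> set (cycle_from p b)"
      by auto
    then have "a \<le> b" using Cons.prems(1) by auto
    with le[OF b] show ?thesis by simp
  qed
  moreover have "cycle_from p a \<noteq> []"
    using mem_cycle_from_self[OF assms(1), of a] by auto
  ultimately show ?case
    using Cons hd_cycle_from[OF assms(1), of a] by simp
qed simp

lemma standard_cycles_standard_cycle_form:
  assumes "p permutes {1..n}"
  shows "standard_cycles (standard_cycle_form n p)"
  unfolding standard_cycle_form_altdef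
proof (rule standard_cycles_map_cycle_from)
  show "permutation p" using assms by (auto simp: permutation_permutes)
  show "sorted (cycle_minima n p)"
    unfolding cycle_minima_def by (intro sorted_wrt_filter sorted_upt)
  show "\<forall>a\<in>set (cycle_minima n p). a = Min (set (cycle_from p a))"
    unfolding set_cycle_minima by blast
qed

text \<open>A permutation acts on each listed cycle as \<open>cycle_of_list\<close> of that list,
  and the cycles cover \<open>{1..n}\<close>, so the form determines every value.\<close>

lemma inj_on_standard_cycle_form: "inj_on (standard_cycle_form n) {p. p permutes {1..n}}"
proof (rule inj_onI, rule ext)
  fix p p' x
  assume p: "p \<in> {p. p permutes {1..n}}" and p': "p' \<in> {p. p permutes {1..n}}"
    and eq: "standard_cycle_form n p = standard_cycle_form n p'"
  have perm: "permutation p" "permutation p'" using p p' by (auto simp: permutation_permutes)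
  have cyc: "r x = cycle_of_list c x" if "permutation r" "c = cycle_from r a" "x \<in> set c" for r c a
    using cycle_restrict[OF that(1), of x a] that(2,3) by (simp only: cycle_from_def)
  show "p x = p' x"
  proof (cases "x \<in> {1..n}")
    case True
    then have "x \<in> set (Flatten n p)" using set_Flatten p by blast
    then obtain c where c: "c \<in> set (standard_cycle_form n p)" "x \<in> set c"
      by (auto simp: Flatten_def)
    then obtain a where a: "c = cycle_from p a"
      unfolding standard_cycle_form_altdef by auto
    from c eq obtain a' where a': "c = cycle_from p' a'"
      unfolding standard_cycle_form_altdef by auto
    show ?thesis
      using cyc[OF perm(1) a c(2)] cyc[OF perm(2) a' c(2)] by simp
  next
    case False
    then show ?thesis using p p' by (auto simp: permutes_def)
  qed
qed


section \<open>Splitting off the first letter\<close>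

text \<open>The increasing enumeration of the naturals other than \<open>j\<close>; it turns a word
  on an initial segment into a possible remainder after a first letter \<open>j\<close>.\<close>

definition skip :: "nat \<Rightarrow> nat \<Rightarrow> nat" where
  "skip j i = (if i < j then i else Suc i)"

lemma strict_mono_skip: "strict_mono (skip j)"
  by (rule strict_monoI) (auto simp: skip_def)

lemma skip_image:
  assumes "j \<le> m"
  shows "skip j ` {..<m} = {..<Suc m} - {j}"
proof (intro equalityI subsetI)
  fix x assume "x \<in> {..<Suc m} - {j}"
  then show "x \<in> skip j ` {..<m}"
    using assms by (cases "x < j") (auto simp: skip_def image_iff intro: bexI[of _ x] bexI[of _ "x - 1"])
qed (use assms in \<open>auto simp: skip_def\<close>)

abbreviation perms :: "nat \<Rightarrow> nat list set" where
  "perms m \<equiv> permutations_of_set {..<m}"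

lemma sum_permutations_of_set_image:
  assumes "strict_mono (f :: nat \<Rightarrow> nat)"
  shows "(\<Sum>w\<in>permutations_of_set (f ` A). F w) = (\<Sum>w\<in>permutations_of_set A. F (map f w))"
proof -
  have inj: "inj f" using assms by (rule strict_mono_imp_inj_on)
  then have "inj_on f A" by (rule inj_on_subset) simp
  then show ?thesis
    using inj by (simp add: permutations_of_set_image_inj sum.reindex inj_on_def)
qed

lemma sum_perms_Suc:
  "(\<Sum>w\<in>perms (Suc m). F w) = (\<Sum>j\<le>m. \<Sum>w\<in>perms m. F (j # map (skip j) w))"
proof -
  have "(\<Sum>w\<in>perms (Suc m). F w) =
        (\<Sum>w\<in>(\<Union>j\<in>{..m}. (#) j ` permutations_of_set ({..<Suc m} - {j})). F w)"
    by (subst permutations_of_set_nonempty) (auto simp: lessThan_Suc_atMost)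
  also have "\<dots> = (\<Sum>j\<le>m. \<Sum>w\<in>(#) j ` permutations_of_set ({..<Suc m} - {j}). F w)"
    by (subst sum.UNION_disjoint) auto
  also have "\<dots> = (\<Sum>j\<le>m. \<Sum>w\<in>perms m. F (j # map (skip j) w))"
  proof (rule sum.cong)
    fix j assume "j \<in> {..m}"
    then have "permutations_of_set ({..<Suc m} - {j}) = permutations_of_set (skip j ` {..<m})"
      by (simp add: skip_image)
    then show "(\<Sum>w\<in>(#) j ` permutations_of_set ({..<Suc m} - {j}). F w) =
          (\<Sum>w\<in>perms m. F (j # map (skip j) w))"
      by (simp add: sum.reindex sum_permutations_of_set_image[OF strict_mono_skip])
  qed simp
  finally show ?thesis .
qed

lemma flatten_weight_map:
  assumes "strict_mono (f :: nat \<Rightarrow> nat)"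
  shows "flatten_weight (map f w) = flatten_weight w"
  by (induction w) (use assms in \<open>simp_all add: strict_mono_less_eq\<close>)

lemma flatten_weight_skip:
  assumes "w \<in> perms m" "j \<le> m"
  shows "flatten_weight (j # map (skip j) w) = flatten_weight w * (if j = 0 then 2 else 1)"
proof -
  have "(\<forall>y\<in>set (map (skip j) w). j \<le> y) \<longleftrightarrow> j = 0"
    using assms by (auto simp: permutations_of_set_def skip_def)
  then show ?thesis
    by (simp add: flatten_weight_map[OF strict_mono_skip])
qed

text \<open>Among the \<open>m + 1\<close> first letters only 0 counts twice, so each step
  multiplies by \<open>m + 2\<close>. The total serves to count the standard forms.\<close>

lemma sum_flatten_weight: "(\<Sum>w\<in>perms m. flatten_weight w) = fact (Suc m)"
proof (induction m)
  case (Suc m)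
  have "(\<Sum>w\<in>perms (Suc m). flatten_weight w) =
        (\<Sum>j\<le>m. \<Sum>w\<in>perms m. flatten_weight w * (if j = 0 then 2 else 1))"
    unfolding sum_perms_Suc by (intro sum.cong) (auto simp: flatten_weight_skip simp del: flatten_weight.simps)
  also have "\<dots> = (\<Sum>j\<le>m. fact (Suc m) * (if j = 0 then 2 else 1))"
    by (simp only: sum_distrib_right[symmetric] Suc.IH)
  also have "\<dots> = fact (Suc m) * (\<Sum>j\<le>m. if j = 0 then 2 else 1)"
    by (simp only: sum_distrib_left)
  also have "(\<Sum>j\<le>m. if j = 0 then 2 else 1 :: nat) = Suc (Suc m)"
    by (induction m) auto
  finally show ?case by simp
qed simp


section \<open>Summing over permutations\<close>

lemma permutations_of_set_interval:
  "permutations_of_set {2..Suc m} = map (\<lambda>i. i + 2) ` perms m"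
proof -
  have "(\<lambda>i. i + 2) ` {..<m} = {2..Suc m}"
  proof (intro equalityI subsetI)
    fix x assume "x \<in> {2..Suc m}"
    then have "x = (x - 2) + 2" "x - 2 \<in> {..<m}" by auto
    then show "x \<in> (\<lambda>i. i + 2) ` {..<m}" by blast
  qed auto
  then show ?thesis
    by (metis permutations_of_set_image_inj inj_on_add')
qed

lemma strict_mono_plus_2: "strict_mono (\<lambda>i::nat. i + 2)"
  by (rule strict_monoI) simp

lemma sum_words_interval:
  "(\<Sum>w\<in>permutations_of_set {2..Suc m}. F w) = (\<Sum>w\<in>perms m. F (map (\<lambda>i. i + 2) w))"
proof -
  have "inj_on (map (\<lambda>i::nat. i + 2)) (perms m)"
    by (rule inj_on_subset[OF inj_mapI]) (auto intro: injI)
  then show ?thesis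
    unfolding permutations_of_set_interval by (simp only: sum.reindex o_def)
qed

definition standard_forms :: "nat \<Rightarrow> nat list list set" where
  "standard_forms n = {css. standard_cycles css \<and> concat css \<in> permutations_of_set {1..n}}"

lemma standard_forms_Suc:
  "standard_forms (Suc m) = (\<Union>w\<in>permutations_of_set {2..Suc m}. cuttings (1 # w))"
proof -
  have eq: "cuttings (1 # w) = {css. standard_cycles css \<and> concat css = 1 # w}"
    if "w \<in> permutations_of_set {2..Suc m}" for w
    using that by (intro standard_cycles_eq_cuttings[symmetric]) (auto simp: permutations_of_set_def)
  show ?thesis
  proof (intro equalityI subsetI)
    fix css assume css: "css \<in> standard_forms (Suc m)"
    then have std: "standard_cycles css" and set: "set (concat css) = {1..Suc m}"
      and dist: "distinct (concat css)"
      by (auto simp: standard_forms_def permutations_of_set_def)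
    then obtain c cs where c: "css = c # cs" "c \<noteq> []" by (cases css) auto
    have mem: "hd c \<in> set (concat css)" using c by simp
    have min: "\<forall>y\<in>set (concat css). hd c \<le> y" using std c by simp
    \<comment> \<open>The head is itself a letter, hence at least 1, and it is at most the letter
      1.\<close>
    have "hd c = 1"
      using mem min[rule_format, of 1] unfolding set by simp
    then obtain w where w: "concat css = 1 # w" using c by (cases c) auto
    have "w \<in> permutations_of_set {2..Suc m}"
    proof
      show "distinct w" using dist w by simp
      have "insert 1 (set w) = {1..Suc m}" "1 \<notin> set w"
        using set dist unfolding w by simp_all
      then have "set w = {1..Suc m} - {1}" by blast
      also have "\<dots> = {2..Suc m}" by auto
      finally show "set w = {2..Suc m}" .
    qed
    then show "css \<in> (\<Union>w\<in>permutations_of_set {2..Suc m}. cuttings (1 # w))"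
      using std w eq by blast
  next
    fix css assume "css \<in> (\<Union>w\<in>permutations_of_set {2..Suc m}. cuttings (1 # w))"
    then obtain w where w: "w \<in> permutations_of_set {2..Suc m}" "css \<in> cuttings (1 # w)" by blast
    then have "standard_cycles css" "concat css = 1 # w" using eq by auto
    moreover have "1 # w \<in> permutations_of_set {1..Suc m}"
      using w(1) by (auto simp: permutations_of_set_def)
    ultimately show "css \<in> standard_forms (Suc m)" by (simp add: standard_forms_def)
  qed
qed

lemma cuttings_disjoint: "v \<noteq> w \<Longrightarrow> cuttings v \<inter> cuttings w = {}"
  by (auto simp: cuttings_def)

text \<open>All cuttings of a word share its concatenation, so each word contributes its number of
  cuttings.\<close>

lemma sum_standard_forms:
  fixes F :: "nat list \<Rightarrow> 'a :: comm_semiring_1"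
  shows "(\<Sum>css\<in>standard_forms (Suc m). F (concat css)) =
         (\<Sum>w\<in>perms m. of_nat (flatten_weight w) * F (1 # map (\<lambda>i. i + 2) w))"
proof -
  have "(\<Sum>css\<in>standard_forms (Suc m). F (concat css)) =
        (\<Sum>w\<in>permutations_of_set {2..Suc m}. \<Sum>css\<in>cuttings (1 # w). F (concat css))"
    unfolding standard_forms_Suc
    by (rule sum.UNION_disjoint) (use card_cuttings cuttings_disjoint in auto)
  also have "\<dots> = (\<Sum>w\<in>permutations_of_set {2..Suc m}. \<Sum>css\<in>cuttings (1 # w). F (1 # w))"
    by (intro sum.cong) (auto simp: cuttings_def)
  also have "\<dots> = (\<Sum>w\<in>permutations_of_set {2..Suc m}. of_nat (flatten_weight w) * F (1 # w))"
    by (simp add: card_cuttings)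
  also have "\<dots> = (\<Sum>w\<in>perms m. of_nat (flatten_weight w) * F (1 # map (\<lambda>i. i + 2) w))"
    unfolding sum_words_interval flatten_weight_map[OF strict_mono_plus_2] ..
  finally show ?thesis .
qed

text \<open>Surjectivity comes for free, since both sides have \<open>n!\<close> elements.\<close>

lemma bij_betw_standard_cycle_form:
  "bij_betw (standard_cycle_form (Suc m)) {p. p permutes {1..Suc m}} (standard_forms (Suc m))"
proof -
  let ?f = "standard_cycle_form (Suc m)" and ?P = "{p. p permutes {1..Suc m}}"
  have sub: "?f ` ?P \<subseteq> standard_forms (Suc m)"
  proof safe
    fix p assume p: "p permutes {1..Suc m}"
    have "concat (?f p) \<in> permutations_of_set {1..Suc m}"
      using set_Flatten[OF p] distinct_Flatten[OF p]
      unfolding Flatten_def by (rule permutations_of_setI)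
    then show "?f p \<in> standard_forms (Suc m)"
      using standard_cycles_standard_cycle_form[OF p] by (simp add: standard_forms_def)
  qed
  have fin: "finite (standard_forms (Suc m))"
    unfolding standard_forms_Suc using card_cuttings by auto
  have "card (standard_forms (Suc m)) = fact (Suc m)"
    using sum_standard_forms[of "\<lambda>_. 1 :: nat" m] sum_flatten_weight[of m] by simp
  also have "\<dots> = card (?f ` ?P)"
    using inj_on_standard_cycle_form[of "Suc m"]
    by (subst card_image) (auto simp: card_permutations)
  finally have "?f ` ?P = standard_forms (Suc m)"
    using card_subset_eq[OF fin sub] by simp
  then show ?thesis
    using inj_on_standard_cycle_form by (simp add: bij_betw_def)
qed

lemma sum_Flatten:
  fixes F :: "nat list \<Rightarrow> 'a :: comm_semiring_1"
  shows "(\<Sum>p | p permutes {1..Suc m}. F (Flatten (Suc m) p)) =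
         (\<Sum>w\<in>perms m. of_nat (flatten_weight w) * F (1 # map (\<lambda>i. i + 2) w))"
  unfolding sum_standard_forms[symmetric] Flatten_def
  by (rule sum.reindex_bij_betw[OF bij_betw_standard_cycle_form])


section \<open>The recursion in the first letter\<close>

definition weight :: "nat list \<Rightarrow> int poly" where
  "weight w = of_nat (flatten_weight w) * q ^ valleys w"

definition word_total :: "nat \<Rightarrow> int poly" where
  "word_total m = (\<Sum>w\<in>perms m. weight w)"

text \<open>The words enumerated here are those on the \<open>m + 1\<close> letters \<open>0, \<dots>, m\<close>.\<close>

definition starting :: "nat \<Rightarrow> nat \<Rightarrow> int poly" where
  "starting m j = (\<Sum>w\<in>perms m. weight (j # map (skip j) w))"

text \<open>Words with fewer than two letters count as having no ascent: a letter put in front of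
  them creates no valley, since a valley needs a right neighbour.\<close>

fun ascent_first :: "nat list \<Rightarrow> bool" where
  "ascent_first (x # y # w) \<longleftrightarrow> x < y"
| "ascent_first _ \<longleftrightarrow> False"

definition ascending :: "nat \<Rightarrow> nat \<Rightarrow> int poly" where
  "ascending m i = (\<Sum>w\<in>perms m. weight w * of_bool (ascent_first w \<and> hd w = i))"

lemma word_total_0: "word_total 0 = 1"
  by (simp add: word_total_def weight_def valleys_short)

lemma word_total_Suc: "word_total (Suc m) = (\<Sum>j\<le>m. starting m j)"
  unfolding word_total_def starting_def by (rule sum_perms_Suc)

text \<open>A leading 0 is a new right-to-left minimum, hence the factor 2, and it creates no valley
  because the next letter is larger.\<close>

lemma weight_skip_0:
  assumes "w \<in> perms m"
  shows "weight (0 # map (skip 0) w) = 2 * weight w"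
proof -
  have "valleys (0 # map (skip 0) w) = valleys w"
    by (subst valleys_Cons_min) (auto simp: skip_def valleys_map[OF strict_mono_skip])
  then show ?thesis
    unfolding weight_def using flatten_weight_skip[OF assms, of 0] by simp
qed

lemma starting_0: "starting m 0 = 2 * word_total m"
  unfolding starting_def word_total_def sum_distrib_left
  by (rule sum.cong) (simp_all add: weight_skip_0)

text \<open>A first letter \<open>j > 0\<close> is not a right-to-left minimum, so prepending it only matters
  through the valley it may create at the next letter.\<close>

lemma weight_skip:
  assumes "w \<in> perms m" "0 < j" "j \<le> m"
  shows "weight (j # map (skip j) w) = weight w - \<theta> * (weight w * of_bool (ascent_first w \<and> hd w < j))"
proof -
  have "valleys (j # map (skip j) w) = of_bool (ascent_first w \<and> hd w < j) + valleys w"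
  proof (cases w rule: ascent_first.cases)
    case (1 x y v)
    have "x \<noteq> y" using assms(1) 1 by (auto simp: permutations_of_set_def)
    have "valleys (j # map (skip j) w) =
        of_bool (skip j x \<le> j \<and> skip j x \<le> skip j y) + valleys (map (skip j) w)"
      unfolding 1 list.map by (rule valleys_Cons)
    also have "skip j x \<le> j \<and> skip j x \<le> skip j y \<longleftrightarrow> ascent_first w \<and> hd w < j"
      using 1 \<open>x \<noteq> y\<close> by (auto simp: skip_def)
    finally show ?thesis by (simp add: valleys_map[OF strict_mono_skip])
  qed (simp_all add: valleys_short)
  then show ?thesis
    unfolding weight_def \<theta>_def using flatten_weight_skip[OF assms(1,3)] assms(2)
    by (simp add: power_add algebra_simps)
qed

text \<open>The words that lose a factor are sorted by their first letter, so that increasing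
  \<open>j\<close> by one adds a single \<open>ascending\<close> term.\<close>

lemma starting_eq:
  assumes "0 < j" "j \<le> m"
  shows "starting m j = word_total m - \<theta> * (\<Sum>i<j. ascending m i)"
proof -
  have "starting m j =
        (\<Sum>w\<in>perms m. weight w - \<theta> * (weight w * of_bool (ascent_first w \<and> hd w < j)))"
    unfolding starting_def by (rule sum.cong) (use assms weight_skip in auto)
  also have "\<dots> = word_total m - \<theta> * (\<Sum>w\<in>perms m. weight w * of_bool (ascent_first w \<and> hd w < j))"
    unfolding word_total_def sum_subtractf sum_distrib_left ..
  also have "(\<Sum>w\<in>perms m. weight w * of_bool (ascent_first w \<and> hd w < j)) =
        (\<Sum>w\<in>perms m. \<Sum>i<j. weight w * of_bool (ascent_first w \<and> hd w = i))"
    by (intro sum.cong) (auto simp: sum_distrib_left[symmetric] of_bool_def)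
  also have "\<dots> = (\<Sum>i<j. ascending m i)"
    unfolding ascending_def by (rule sum.swap)
  finally show ?thesis .
qed

lemma ascending_Suc:
  assumes "i \<le> m"
  shows "ascending (Suc m) i =
         (\<Sum>w\<in>perms m. weight (i # map (skip i) w) * of_bool (w \<noteq> [] \<and> i \<le> hd w))"
proof -
  \<comment> \<open>The letter after \<open>j\<close> is \<open>skip j (hd w)\<close>, which exceeds
    \<open>j\<close> exactly when \<open>j \<le> hd w\<close>.\<close>
  have asc: "ascent_first (j # map (skip j) w) \<longleftrightarrow> w \<noteq> [] \<and> j \<le> hd w" for j w
    by (cases w) (auto simp: skip_def)
  define F where "F j w = weight (j # map (skip j) w) * of_bool (w \<noteq> [] \<and> j \<le> hd w)" for j w
  have "ascending (Suc m) i = (\<Sum>j\<le>m. \<Sum>w\<in>perms m. F j w * of_bool (j = i))"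
    unfolding ascending_def sum_perms_Suc asc F_def
    by (intro sum.cong refl) (simp only: list.sel of_bool_conj mult.assoc)
  also have "\<dots> = (\<Sum>j\<le>m. if j = i then \<Sum>w\<in>perms m. F i w else 0)"
    by (rule sum.cong) auto
  also have "\<dots> = (\<Sum>w\<in>perms m. F i w)" using assms by simp
  finally show ?thesis unfolding F_def .
qed

lemma ascending_1: "ascending (Suc 0) 0 = 0"
  by (simp add: ascending_Suc)

lemma ascending_0: "ascending (Suc (Suc m)) 0 = 2 * word_total (Suc m)"
proof -
  have "w \<noteq> []" if "w \<in> perms (Suc m)" for w
    using length_finite_permutations_of_set[OF that] by auto
  then show ?thesis
    unfolding ascending_Suc[of 0 "Suc m", simplified] word_total_def sum_distrib_left
    by (intro sum.cong) (auto simp: weight_skip_0)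
qed

text \<open>A positive first letter followed by a larger one creates no valley and is no
  right-to-left minimum, so deleting it keeps the weight.\<close>

lemma ascending_pos:
  assumes "0 < i" "i \<le> Suc m"
  shows "ascending (Suc (Suc m)) i = (\<Sum>j=i..m. starting m j)"
proof -
  have "ascending (Suc (Suc m)) i =
      (\<Sum>w\<in>perms (Suc m). weight w * of_bool (w \<noteq> [] \<and> i \<le> hd w))"
    unfolding ascending_Suc[OF assms(2)] by (intro sum.cong) (use assms in \<open>auto simp: weight_skip\<close>)
  also have "\<dots> = (\<Sum>j\<le>m. if i \<le> j then starting m j else 0)"
    unfolding sum_perms_Suc starting_def by (intro sum.cong) auto
  also have "\<dots> = (\<Sum>j\<in>{i..m}. starting m j)"
    by (rule sum.mono_neutral_cong_right) auto
  finally show ?thesis .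
qed

text \<open>A single letter has no ascent, so the correction in \<open>starting_Suc_1\<close> is
  missing here. The surplus of \<open>2 * \<theta>\<close> over the closed form is the source of the
  extra term.\<close>

lemma starting_1: "starting (Suc 0) (Suc 0) = word_total (Suc 0)"
  by (simp add: starting_eq ascending_1)

lemma starting_Suc_1: "starting (m + 2) 1 = word_total (m + 2) - 2 * \<theta> * word_total (m + 1)"
  by (simp add: starting_eq ascending_0)

lemma starting_step:
  assumes "0 < j" "j \<le> Suc m"
  shows "starting (m + 2) (Suc j) = starting (m + 2) j - \<theta> * (\<Sum>l=j..m. starting m l)"
  using assms by (simp add: starting_eq ascending_pos algebra_simps)

text \<open>The second base case: \<open>starting_rec\<close> starts from a positive letter, since
  the first letter 0 carries its own factor 2. That factor is removed here by subtracting
  \<open>starting m 0\<close> from \<open>word_total (m + 1)\<close>.\<close>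

lemma starting_2:
  "starting (m + 2) 2 = word_total (m + 2) - 3 * \<theta> * word_total (m + 1) + 2 * \<theta> * word_total m"
proof -
  have "{..m} = insert 0 {1..m}" by auto
  then have "word_total (Suc m) = 2 * word_total m + (\<Sum>l=1..m. starting m l)"
    unfolding word_total_Suc by (simp add: starting_0)
  then have "(\<Sum>l=1..m. starting m l) = word_total (Suc m) - 2 * word_total m" by simp
  with starting_step[of 1 m]
  have "starting (m + 2) 2 = starting (m + 2) 1 - \<theta> * (word_total (m + 1) - 2 * word_total m)"
    by (simp add: numeral_2_eq_2)
  then show ?thesis
    unfolding starting_Suc_1 by (simp add: algebra_simps)
qed

text \<open>A second difference: the tail sums in two consecutive instances of
  \<open>starting_step\<close> differ by \<open>starting m j\<close>.\<close>

lemma starting_rec: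
  assumes "0 < j" "j \<le> m"
  shows "starting (m + 2) (j + 2) = 2 * starting (m + 2) (j + 1) - starting (m + 2) j + \<theta> * starting m j"
proof -
  have "(\<Sum>l=j..m. starting m l) = starting m j + (\<Sum>l=Suc j..m. starting m l)"
    using assms(2) by (rule sum.atLeast_Suc_atMost)
  with starting_step[of j m] starting_step[of "Suc j" m] assms show ?thesis
    by (simp add: algebra_simps)
qed


section \<open>Solving the recursion\<close>

text \<open>These are the numbers \<open>\<beta>\<close> with shifted arguments:
  \<open>coef j i\<close> equals \<open>\<beta> (j + 2) (i + 1)\<close> for positive
  \<open>j\<close>.\<close>

definition coef :: "nat \<Rightarrow> nat \<Rightarrow> nat" where
  "coef j i = (j choose i) + (if i = 0 then 0 else (j - 1) choose (i - 1))"

lemma coef_eq_0: "0 < j \<Longrightarrow> j < i \<Longrightarrow> coef j i = 0"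
  by (auto simp: coef_def)

lemma coef_0: "coef j 0 = 1"
  by (simp add: coef_def)

lemma coef_1: "0 < j \<Longrightarrow> coef j 1 = j + 1"
  by (simp add: coef_def)

text \<open>Pascal's rule twice: the second difference in the upper index lowers both indices of a
  binomial coefficient to \<open>j\<close> and \<open>i\<close>. Positivity of \<open>j\<close>
  keeps \<open>j - 1\<close> from being truncated.\<close>

lemma coef_rec:
  assumes "0 < j"
  shows "coef (j + 2) (i + 2) + coef j (i + 2) = 2 * coef (j + 1) (i + 2) + coef j i"
proof -
  obtain j' where "j = Suc j'" using assms by (cases j) auto
  then show ?thesis by (cases i) (simp_all add: coef_def)
qed

definition closed_form :: "nat \<Rightarrow> nat \<Rightarrow> int poly" where
  "closed_form m j = (\<Sum>i\<le>j. of_nat (coef j i) * b_v (i + 1) * word_total (m - i))"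

lemma b_v_add_2: "b_v (i + 2) = \<theta> * b_v i"
  by (simp add: b_v_def)

lemma b_v_small: "b_v (Suc 0) = 1" "b_v (Suc (Suc 0)) = - \<theta>" "b_v (Suc (Suc (Suc 0))) = \<theta>"
  by (simp_all add: b_v_def)

lemma closed_form_extend:
  assumes "0 < j" "j \<le> N"
  shows "closed_form m j = (\<Sum>i\<le>N. of_nat (coef j i) * b_v (i + 1) * word_total (m - i))"
  unfolding closed_form_def
  by (rule sum.mono_neutral_left) (use assms in \<open>auto simp: coef_eq_0\<close>)

lemma closed_form_rec:
  assumes "0 < j"
  shows "closed_form (m + 2) (j + 2) =
         2 * closed_form (m + 2) (j + 1) - closed_form (m + 2) j + \<theta> * closed_form m j"
proof -
  define f where "f i = b_v (i + 1) * word_total (m + 2 - i)" for i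
  \<comment> \<open>\<open>coef_rec\<close> covers the indices from 2 on. The terms 0 and 1 are
    split off; their coefficients 1 and \<open>j + 1\<close> have second difference zero.\<close>
  have split: "(\<Sum>i\<le>j + 2. h i) = h 0 + h 1 + (\<Sum>i\<le>j. h (i + 2))" for h :: "nat \<Rightarrow> int poly"
    by (simp add: sum.atMost_Suc_shift del: sum.atMost_Suc)
  have ext: "closed_form (m + 2) j' = (\<Sum>i\<le>j + 2. of_nat (coef j' i) * f i)"
    if "0 < j'" "j' \<le> j + 2" for j'
    unfolding closed_form_extend[OF that] f_def by (simp add: mult.assoc)
  have "\<theta> * closed_form m j = (\<Sum>i\<le>j. of_nat (coef j i) * f (i + 2))"
    unfolding closed_form_def sum_distrib_left
    by (intro sum.cong) (simp_all add: f_def b_v_add_2[of "Suc _", simplified] mult_ac)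
  moreover have "(\<Sum>i\<le>j. of_nat (coef (j + 2) (i + 2)) * f (i + 2)) + (\<Sum>i\<le>j. of_nat (coef j (i + 2)) * f (i + 2)) =
      2 * (\<Sum>i\<le>j. of_nat (coef (j + 1) (i + 2)) * f (i + 2)) + (\<Sum>i\<le>j. of_nat (coef j i) * f (i + 2))"
    unfolding sum.distrib[symmetric] sum_distrib_left
  proof (rule sum.cong)
    fix i
    have "of_nat (coef (j + 2) (i + 2)) + of_nat (coef j (i + 2)) =
        2 * of_nat (coef (j + 1) (i + 2)) + (of_nat (coef j i) :: int poly)"
      using arg_cong[OF coef_rec[OF assms, of i], of "of_nat :: nat \<Rightarrow> int poly"] by simp
    from arg_cong[OF this, of "\<lambda>c. c * f (i + 2)"]
    show "of_nat (coef (j + 2) (i + 2)) * f (i + 2) + of_nat (coef j (i + 2)) * f (i + 2) =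
        2 * (of_nat (coef (j + 1) (i + 2)) * f (i + 2)) + of_nat (coef j i) * f (i + 2)"
      by (simp only: distrib_right mult.assoc)
  qed simp
  moreover have "closed_form (m + 2) j = (\<Sum>i\<le>j + 2. of_nat (coef j i) * f i)"
    and "closed_form (m + 2) (j + 1) = (\<Sum>i\<le>j + 2. of_nat (coef (j + 1) i) * f i)"
    and "closed_form (m + 2) (j + 2) = (\<Sum>i\<le>j + 2. of_nat (coef (j + 2) i) * f i)"
    by (rule ext; use assms in simp)+
  ultimately show ?thesis
    unfolding split
    using assms by (simp add: coef_0 coef_1[simplified] algebra_simps)
qed

text \<open>The recursion goes down two letters at a time, to the base cases 1 and 2. The extra term
  starts at \<open>j = m = 1\<close> and gains a factor \<open>\<theta>\<close> whenever
  \<open>j\<close> and \<open>m\<close> both grow by 2.\<close>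

lemma starting_closed_form:
  assumes "0 < j" "j \<le> m"
  shows "starting m j = closed_form m j + 2 * \<theta> ^ ((m + 1) div 2) * of_bool (odd m \<and> j = m)"
  using assms
proof (induction j arbitrary: m rule: less_induct)
  case (less j)
  consider "j = 1" "m = 1" | "j = 1" "m \<ge> 2" | "j = 2" | "j \<ge> 3"
    using less.prems by linarith
  then show ?case
  proof cases
    case 1
    then show ?thesis
      by (simp add: starting_1 closed_form_def coef_def b_v_def word_total_0)
  next
    case 2
    then obtain m' where "m = m' + 2" by (metis le_add_diff_inverse2)
    then show ?thesis
      using 2 starting_Suc_1[of m'] by (simp add: closed_form_def coef_def b_v_def)
  next
    case 3
    then obtain m' where "m = m' + 2" using less.prems by (metis le_add_diff_inverse2)
    moreover have "closed_form (m' + 2) 2 = word_total (m' + 2) - 3 * \<theta> * word_total (m' + 1) + 2 * \<theta> * word_total m'"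
      by (simp add: closed_form_def coef_def b_v_small numeral_2_eq_2)
    moreover have "\<not> (odd m \<and> j = m)" using 3 by auto
    ultimately show ?thesis
      using 3 starting_2[of m'] by simp
  next
    case 4
    define i where "i = j - 2"
    define m' where "m' = m - 2"
    have j: "j = i + 2" and m: "m = m' + 2" and i: "0 < i" "i \<le> m'"
      using 4 less.prems by (auto simp: i_def m'_def)
    \<comment> \<open>Both letters are below \<open>m\<close>, so only the value for
      \<open>m'\<close> can carry the extra term.\<close>
    have "starting m (i + 1) = closed_form m (i + 1)" "starting m i = closed_form m i"
      using less.IH[of "i + 1" m] less.IH[of i m] i by (auto simp: j m)
    moreover have "starting m' i = closed_form m' i + 2 * \<theta> ^ ((m' + 1) div 2) * of_bool (odd m' \<and> i = m')"
      using less.IH[of i m'] i by (simp add: j)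
    ultimately show ?thesis
      unfolding j m starting_rec[OF i] closed_form_rec[OF i(1)]
      by (simp add: algebra_simps)
  qed
qed

section \<open>Translation back to \<open>g_v\<close>\<close>

lemma valleys_Cons_1: "valleys (1 # map (\<lambda>i. i + 2) w) = valleys w"
  by (subst valleys_Cons_min) (auto simp: valleys_map[OF strict_mono_plus_2, simplified])

lemma g_v_eq:
  "g_v (Suc m) as = (\<Sum>w\<in>perms m. weight w * of_bool (prefix as (1 # map (\<lambda>i. i + 2) w)))"
proof -
  have "g_v (Suc m) as = (\<Sum>p | p permutes {1..Suc m}.
      q ^ valleys (Flatten (Suc m) p) * of_bool (prefix as (Flatten (Suc m) p)))"
    unfolding g_v_def by (rule sum.mono_neutral_cong_left) (auto simp: finite_permutations)
  also have "\<dots> = (\<Sum>w\<in>perms m. of_nat (flatten_weight w) * (q ^ valleys (1 # map (\<lambda>i. i + 2) w) *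
      of_bool (prefix as (1 # map (\<lambda>i. i + 2) w))))"
    by (rule sum_Flatten)
  finally show ?thesis
    by (simp only: valleys_Cons_1 weight_def mult.assoc)
qed

lemma g_v_1: "g_v (Suc m) [1] = word_total m"
  by (simp add: g_v_eq word_total_def)

text \<open>Shifting by 2 behind the initial 1 turns a first letter \<open>j\<close> into a second
  letter \<open>j + 2\<close>.\<close>

lemma g_v_1_k:
  assumes "j \<le> m"
  shows "g_v (m + 2) [1, j + 2] = starting m j"
proof -
  have "g_v (m + 2) [1, j + 2] = (\<Sum>i\<le>m. if i = j then starting m j else 0)"
    unfolding add_2_eq_Suc' g_v_eq sum_perms_Suc starting_def by (intro sum.cong) auto
  then show ?thesis using assms by simp
qed

text \<open>The power of the square root of \<open>\<theta>\<close> is written with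
  \<open>div 2\<close>, which is exact because the term only occurs for odd
  \<open>n\<close>.\<close>

theorem theorem3p13:
  fixes n k :: nat
  assumes "n \<ge> k" and "k \<ge> 3"
  shows "g_v n [1, k] =
           (\<Sum>i = 1..k - 1. of_nat (\<beta> k i) * b_v i * g_v (n - i) [1])
           + 2 * \<theta> ^ ((n - 1) div 2) * of_bool (odd n \<and> k = n)"
proof -
  define m where "m = n - 2"
  define j where "j = k - 2"
  have n: "n = m + 2" and k: "k = j + 2" and j: "0 < j" "j \<le> m"
    using assms by (auto simp: m_def j_def)
  \<comment> \<open>For \<open>i = 0\<close> the second binomial coefficient of
    \<open>\<beta>\<close> has lower index -1 and vanishes, matching the case distinction in
    \<open>coef\<close>.\<close>
  have coef: "\<beta> k (i + 1) = coef j i" for i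
    using j by (cases i) (auto simp: \<beta>_def binom_def coef_def k nat_add_distrib)
  have "(\<Sum>i = 1..k - 1. of_nat (\<beta> k i) * b_v i * g_v (n - i) [1]) =
        (\<Sum>i\<le>j. of_nat (\<beta> k (i + 1)) * b_v (i + 1) * g_v (n - (i + 1)) [1])"
    by (rule sum.reindex_bij_witness[of _ "\<lambda>i. i + 1" "\<lambda>i. i - 1"]) (auto simp: k)
  also have "\<dots> = closed_form m j"
    unfolding closed_form_def
  proof (rule sum.cong)
    fix i assume "i \<in> {..j}"
    then have "n - (i + 1) = Suc (m - i)" using j n by auto
    then show "of_nat (\<beta> k (i + 1)) * b_v (i + 1) * g_v (n - (i + 1)) [1] =
        of_nat (coef j i) * b_v (i + 1) * word_total (m - i)"
      by (simp only: coef g_v_1)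
  qed simp
  finally show ?thesis
    using g_v_1_k[OF j(2)] starting_closed_form[OF j] by (simp add: n k)
qed

end
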